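(* Let $l\ge 2$ and let $\mathcal{H}$ be a finite $l$-uniform linear hypergraph with at least one hyperedge, maximum degree $k$, and chromatic index $\chi'(\mathcal{H})=c$. Let $G$ be the representing graph of $\mathcal{H}$. Then: (a) if $c>k$, then $q(G\boxtimes K_c)=2$; (b) if $c=k$, then $q(G\boxtimes K_{c+1})=2$; (c) if $\mathcal{H}$ is $k$-regular and $c=k$, then $q(G\mathbin{\tilde\boxtimes} K_c)=2$.
   Context: A hypergraph $\mathcal{H}$ is $l$-uniform if every hyperedge has exactly $l$ vertices, and linear if any two distinct hyperedges share at most one vertex. The degree of a vertex is the number of hyperedges containing it; $\mathcal{H}$ is $k$-regular if every vertex has degree $k$. The chromatic index $\chi'(\mathcal{H})$ is the minimum number of colors needed to color the hyperedges so that any two hyperedges sharing a vertex receive different colors. The representing graph $G$ of $\mathcal{H}$ has the same vertex set as $\mathcal{H}$, with an edge between two distinct vertices whenever they lie in a common hyperedge. For a finite simple graph $G$ on $\{1,\dots,n\}$, $\mathcal{S}(G)$ is the set of real symmetric $n\times n$ matrices $A=[a_{ij}]$ such that for $i\ne j$, $a_{ij}\ne0$ iff $ij\in E(G)$ (diagonal unrestricted); $q(A)$ is the number of distinct eigenvalues of $A$ and $q(G)=\min\{q(A):A\in\mathcal{S}(G)\}$. The strong product $G\boxtimes H$ is the graph on $V(G)\times V(H)$ with edges $(g,h)(g,h')$ for $hh'\in E(H)$, $(g,h)(g',h)$ for $gg'\in E(G)$, and $(g,h)(g',h')$ for $gg'\in E(G)$, $hh'\in E(H)$. The modified strong product $G\mathbin{\tilde\boxtimes}H$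 is the graph on $V(G)\times V(H)$ with edges $(g,h)(g',h)$ for $gg'\in E(G)$ and $(g,h)(g',h')$ for $gg'\in E(G)$, $hh'\in E(H)$ (no edges $(g,h)(g,h')$). $K_m$ is the complete graph on $m$ vertices. *)

theory Defs
  imports "Jordan_Normal_Form.Char_Poly" "Graph_Theory.Kuratowski"
begin

section \<open>Hypergraphs\<close>

text \<open>Hyperedges form a set of vertex sets: for uniform linear hypergraphs with edges of size at
  least 2, repeated hyperedges are impossible anyway. Isolated vertices are allowed.\<close>

record 'v hypergraph =
  hverts :: "'v set"
  hedges :: "'v set set"

locale fin_hypergraph =
  fixes H :: "'v hypergraph"
  assumes finite_hverts: "finite (hverts H)"
    and hedges_subset: "e \<in> hedges H \<Longrightarrow> e \<subseteq> hverts H"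

definition uniform_hypergraph :: "nat \<Rightarrow> 'v hypergraph \<Rightarrow> bool" where
  "uniform_hypergraph l H \<longleftrightarrow> (\<forall>e\<in>hedges H. card e = l)"

definition linear_hypergraph :: "'v hypergraph \<Rightarrow> bool" where
  "linear_hypergraph H \<longleftrightarrow> (\<forall>e\<in>hedges H. \<forall>e'\<in>hedges H. e \<noteq> e' \<longrightarrow> card (e \<inter> e') \<le> 1)"

definition hdegree :: "'v hypergraph \<Rightarrow> 'v \<Rightarrow> nat" where
  "hdegree H v = card {e \<in> hedges H. v \<in> e}"

definition max_hdegree :: "'v hypergraph \<Rightarrow> nat" where
  "max_hdegree H = Max (hdegree H ` hverts H)"

definition regular_hypergraph :: "nat \<Rightarrow> 'v hypergraph \<Rightarrow> bool" where
  "regular_hypergraph k H \<longleftrightarrow> (\<forall>v\<in>hverts H. hdegree H v = k)"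

definition proper_edge_coloring :: "'v hypergraph \<Rightarrow> nat \<Rightarrow> ('v set \<Rightarrow> nat) \<Rightarrow> bool" where
  "proper_edge_coloring H m \<phi> \<longleftrightarrow>
     (\<forall>e\<in>hedges H. \<phi> e < m) \<and>
     (\<forall>e\<in>hedges H. \<forall>e'\<in>hedges H. e \<noteq> e' \<and> e \<inter> e' \<noteq> {} \<longrightarrow> \<phi> e \<noteq> \<phi> e')"

definition chromatic_index :: "'v hypergraph \<Rightarrow> nat" where
  "chromatic_index H = (LEAST m. \<exists>\<phi>. proper_edge_coloring H m \<phi>)"

lemma (in fin_hypergraph) finite_hedges: "finite (hedges H)"
  by (rule finite_subset[of _ "Pow (hverts H)"]) (use finite_hverts hedges_subset in auto)

lemma (in fin_hypergraph) chromatic_index_attained: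
  "\<exists>\<phi>. proper_edge_coloring H (chromatic_index H) \<phi>"
proof -
  obtain f :: "'v set \<Rightarrow> nat" where f: "bij_betw f (hedges H) {0..<card (hedges H)}"
    using ex_bij_betw_finite_nat[OF finite_hedges] by blast
  have "proper_edge_coloring H (card (hedges H)) f"
    unfolding proper_edge_coloring_def
    using bij_betwE[OF f] inj_on_eq_iff[OF bij_betw_imp_inj_on[OF f]] by simp
  then show ?thesis
    unfolding chromatic_index_def
    using LeastI_ex[where P = "\<lambda>m. \<exists>\<phi>. proper_edge_coloring H m \<phi>"] by blast
qed

section \<open>Simple graphs\<close>

text \<open>A finite simple graph is a \<open>pair_graph\<close>: an edge between \<open>u\<close> and \<open>v\<close> is represented by the two
  arcs \<open>(u, v)\<close> and \<open>(v, u)\<close>.\<close>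

definition representing_graph :: "'v hypergraph \<Rightarrow> 'v pair_pre_digraph" where
  "representing_graph H =
     \<lparr> pverts = hverts H, parcs = {(u, v). u \<noteq> v \<and> (\<exists>e\<in>hedges H. u \<in> e \<and> v \<in> e)} \<rparr>"

definition complete_graph :: "nat \<Rightarrow> nat pair_pre_digraph" where
  "complete_graph m =
     \<lparr> pverts = {..<m}, parcs = {(i, j). i < m \<and> j < m \<and> i \<noteq> j} \<rparr>"

definition strong_product ::
    "'a pair_pre_digraph \<Rightarrow> 'b pair_pre_digraph \<Rightarrow> ('a \<times> 'b) pair_pre_digraph"
    (infixl \<open>\<boxtimes>\<close> 70) where
  "G \<boxtimes> H =
     \<lparr> pverts = pverts G \<times> pverts H,
       parcs = {((g, h), (g, h')) | g h h'. g \<in> pverts G \<and> (h, h') \<in> parcs H}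
             \<union> {((g, h), (g', h)) | g g' h. (g, g') \<in> parcs G \<and> h \<in> pverts H}
             \<union> {((g, h), (g', h')) | g g' h h'. (g, g') \<in> parcs G \<and> (h, h') \<in> parcs H} \<rparr>"

definition modified_strong_product ::
    "'a pair_pre_digraph \<Rightarrow> 'b pair_pre_digraph \<Rightarrow> ('a \<times> 'b) pair_pre_digraph"
    (infixl \<open>\<boxtimes>\<^sub>~\<close> 70) where
  "G \<boxtimes>\<^sub>~ H =
     \<lparr> pverts = pverts G \<times> pverts H,
       parcs = {((g, h), (g', h)) | g g' h. (g, g') \<in> parcs G \<and> h \<in> pverts H}
             \<union> {((g, h), (g', h')) | g g' h h'. (g, g') \<in> parcs G \<and> (h, h') \<in> parcs H} \<rparr>"

lemma pair_graphI:
  assumes "finite (pverts G)"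
    and "\<And>u v. (u, v) \<in> parcs G \<Longrightarrow> u \<in> pverts G \<and> v \<in> pverts G \<and> u \<noteq> v \<and> (v, u) \<in> parcs G"
  shows "pair_graph G"
proof -
  have "finite (parcs G)"
    by (rule finite_subset[of _ "pverts G \<times> pverts G"]) (use assms in auto)
  then show ?thesis
    by unfold_locales (use assms in \<open>auto simp: symmetric_def intro: symI\<close>)
qed

lemma pair_graphD:
  assumes "pair_graph G"
  shows "finite (pverts G)"
    and "(u, v) \<in> parcs G \<Longrightarrow> u \<in> pverts G \<and> v \<in> pverts G \<and> u \<noteq> v \<and> (v, u) \<in> parcs G"
proof -
  interpret pair_graph G by fact
  show "finite (pverts G)" by (rule pair_finite_verts)
  show "(u, v) \<in> parcs G \<Longrightarrow> u \<in> pverts G \<and> v \<in> pverts G \<and> u \<noteq> v \<and> (v, u) \<in> parcs G"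
    using in_arcsD1[of u v] in_arcsD2[of u v] pair_no_loops[of "(u, v)"] arcs_symmetric[of u v]
    by simp
qed

lemma (in fin_hypergraph) pair_graph_representing_graph: "pair_graph (representing_graph H)"
  by (rule pair_graphI)
    (use finite_hverts hedges_subset in \<open>auto simp: representing_graph_def\<close>)

lemma complete_digraph_complete_graph: "complete_digraph m (with_proj (complete_graph m))"
  unfolding complete_digraph_pair_def by (auto simp: complete_graph_def)

lemma pair_graph_complete_graph: "pair_graph (complete_graph m)"
  by (rule pair_graphI) (auto simp: complete_graph_def)

lemma pair_graph_strong_product:
  assumes "pair_graph G" "pair_graph H"
  shows "pair_graph (G \<boxtimes> H)"
proof (rule pair_graphI)
  note G = pair_graphD[OF assms(1)] and H = pair_graphD[OF assms(2)]
  show "finite (pverts (G \<boxtimes> H))"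
    using G(1) H(1) by (simp add: strong_product_def)
  fix p p' assume "(p, p') \<in> parcs (G \<boxtimes> H)"
  then show "p \<in> pverts (G \<boxtimes> H) \<and> p' \<in> pverts (G \<boxtimes> H) \<and> p \<noteq> p' \<and> (p', p) \<in> parcs (G \<boxtimes> H)"
    unfolding strong_product_def by (auto dest: G(2) H(2))
qed

lemma pair_graph_modified_strong_product:
  assumes "pair_graph G" "pair_graph H"
  shows "pair_graph (G \<boxtimes>\<^sub>~ H)"
proof (rule pair_graphI)
  note G = pair_graphD[OF assms(1)] and H = pair_graphD[OF assms(2)]
  show "finite (pverts (G \<boxtimes>\<^sub>~ H))"
    using G(1) H(1) by (simp add: modified_strong_product_def)
  fix p p' assume "(p, p') \<in> parcs (G \<boxtimes>\<^sub>~ H)"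
  then show "p \<in> pverts (G \<boxtimes>\<^sub>~ H) \<and> p' \<in> pverts (G \<boxtimes>\<^sub>~ H) \<and> p \<noteq> p' \<and> (p', p) \<in> parcs (G \<boxtimes>\<^sub>~ H)"
    unfolding modified_strong_product_def by (auto dest: G(2) H(2))
qed

section \<open>The minimum number of distinct eigenvalues of a graph\<close>

text \<open>Matrices are indexed by \<open>0, \<dots>, n - 1\<close>, so the vertices of \<open>G\<close> are numbered by some bijection
  \<open>lab\<close>. Ranging over all numberings only adds permutation-similar matrices, which have the same
  eigenvalues.\<close>

definition graph_matrices :: "'a pair_pre_digraph \<Rightarrow> real mat set" where
  "graph_matrices G =
     {A \<in> carrier_mat (card (pverts G)) (card (pverts G)).
        transpose_mat A = A \<and>
        (\<exists>lab. bij_betw lab {..<card (pverts G)} (pverts G) \<and>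
          (\<forall>i<card (pverts G). \<forall>j<card (pverts G).
             i \<noteq> j \<longrightarrow> (A $$ (i, j) \<noteq> 0 \<longleftrightarrow> (lab i, lab j) \<in> parcs G)))}"

text \<open>All eigenvalues of a real symmetric matrix are real, so the real ones suffice.\<close>

definition num_distinct_eigenvalues :: "real mat \<Rightarrow> nat" where
  "num_distinct_eigenvalues A = card {x. eigenvalue A x}"

definition q_graph :: "'a pair_pre_digraph \<Rightarrow> nat" where
  "q_graph G = (LEAST m. \<exists>A\<in>graph_matrices G. num_distinct_eigenvalues A = m)"

lemma q_graph_attained:
  assumes "pair_graph G"
  shows "\<exists>A\<in>graph_matrices G. num_distinct_eigenvalues A = q_graph G"
proof -
  define n where "n = card (pverts G)"
  obtain lab where lab: "bij_betw lab {..<n} (pverts G)"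
    using ex_bij_betw_nat_finite[OF pair_graphD(1)[OF assms]]
    unfolding n_def atLeast0LessThan by blast
  define A :: "real mat" where
    "A = mat n n (\<lambda>(i, j). if (lab i, lab j) \<in> parcs G then 1 else 0)"
  have "transpose_mat A = A"
    by (rule eq_matI) (auto simp: A_def dest: pair_graphD(2)[OF assms])
  moreover have "A \<in> carrier_mat n n"
    by (simp add: A_def)
  moreover have "\<forall>i<n. \<forall>j<n. i \<noteq> j \<longrightarrow> (A $$ (i, j) \<noteq> 0 \<longleftrightarrow> (lab i, lab j) \<in> parcs G)"
    by (simp add: A_def)
  ultimately have "A \<in> graph_matrices G"
    using lab unfolding graph_matrices_def n_def[symmetric]
    by blast
  then show ?thesis
    unfolding q_graph_def
    using LeastI_ex[where P = "\<lambda>m. \<exists>A\<in>graph_matrices G. num_distinct_eigenvalues A = m"] by blast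
qed

end

theory Submission
  imports Defs "Jordan_Normal_Form.Schur_Decomposition" "Jordan_Normal_Form.Jordan_Normal_Form_Uniqueness"
begin

text \<open>
  For each color \<open>i\<close> the hyperedges \<open>e\<close> of color \<open>i\<close> are disjoint, so \<open>Q\<^sub>i = \<Sum>\<^sub>e J\<^sub>e / |e|\<close> is an orthogonal
  projection on the vertex space. If \<open>x\<^sub>0, \<dots>, x\<^sub>m\<^sub>-\<^sub>1\<close> is an orthonormal basis of \<open>m\<close>-space with nowhere zero
  entries, then \<open>P = \<Sum>\<^sub>i Q\<^sub>i \<otimes> x\<^sub>i x\<^sub>i\<^sup>T\<close> is a projection whose block at two distinct vertices is nowhere
  zero if they lie in a common hyperedge and zero otherwise. The diagonal block at \<open>u\<close> is
  \<open>l\<^sup>-\<^sup>1 \<Sum>\<^sub>i\<^sub>\<in>\<^sub>S x\<^sub>i x\<^sub>i\<^sup>T\<close>, where \<open>S\<close> is the set of colors at \<open>u\<close>: it is scalar if all colors occur, and a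
  suitable choice of the basis makes its off-diagonal entries nonzero for every nonempty proper \<open>S\<close>.
  Conversely, a real symmetric matrix with one eigenvalue is scalar, so two eigenvalues are
  needed as soon as there is an edge.
\<close>

section \<open>Distinct eigenvalues of real symmetric matrices\<close>

lemma trace_mult_commute:
  fixes A B :: "'a::comm_ring_1 mat"
  assumes "A \<in> carrier_mat n n" "B \<in> carrier_mat n n"
  shows "(\<Sum>i<n. (A * B) $$ (i, i)) = (\<Sum>i<n. (B * A) $$ (i, i))"
proof -
  have "(\<Sum>i<n. (A * B) $$ (i, i)) = (\<Sum>i<n. \<Sum>j<n. A $$ (i, j) * B $$ (j, i))"
    using assms by (intro sum.cong) (auto simp: scalar_prod_def atLeast0LessThan)
  also have "\<dots> = (\<Sum>j<n. \<Sum>i<n. A $$ (i, j) * B $$ (j, i))"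
    by (rule sum.swap)
  also have "\<dots> = (\<Sum>j<n. (B * A) $$ (j, j))"
    using assms by (intro sum.cong) (auto simp: scalar_prod_def atLeast0LessThan mult.commute)
  finally show ?thesis .
qed

text \<open>The Hermitian form \<open>s\<close> of \<open>A\<close> at \<open>v\<close> equals z
  times the nonzero real number \<open>r\<close>, and it is its own conjugate because
  \<open>A\<close> is real symmetric; so z is real. The characteristic polynomial then makes it an
  eigenvalue of the real matrix itself.\<close>

lemma eigenvalue_of_real_symmetric_mat:
  fixes A :: "real mat" and z :: complex
  assumes A: "A \<in> carrier_mat n n" and sym: "transpose_mat A = A"
    and ev: "eigenvalue (map_mat of_real A) z"
  shows "\<exists>y. z = of_real y \<and> eigenvalue A y"
proof -
  let ?C = "map_mat of_real A :: complex mat"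
  have C: "?C \<in> carrier_mat n n" using A by simp
  from ev C obtain v where v: "v \<in> carrier_vec n" "v \<noteq> 0\<^sub>v n" "?C *\<^sub>v v = z \<cdot>\<^sub>v v"
    by (auto simp: eigenvalue_def eigenvector_def)
  have symA: "A $$ (i, j) = A $$ (j, i)" if "i < n" "j < n" for i j
    using arg_cong[OF sym, of "\<lambda>M. M $$ (i, j)"] A that by simp
  define s where "s = (\<Sum>i<n. \<Sum>j<n. of_real (A $$ (i, j)) * v $ j * cnj (v $ i))"
  define r where "r = (\<Sum>i<n. (cmod (v $ i))\<^sup>2)"
  have row: "(\<Sum>j<n. of_real (A $$ (i, j)) * v $ j) = z * v $ i" if "i < n" for i
    using arg_cong[OF v(3), of "\<lambda>u. u $ i"] A v(1) that
    by (simp add: scalar_prod_def atLeast0LessThan)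
  have "s = (\<Sum>i<n. z * v $ i * cnj (v $ i))"
    unfolding s_def by (intro sum.cong) (simp_all add: row flip: sum_distrib_right)
  also have "\<dots> = z * of_real r"
    by (simp add: r_def sum_distrib_left mult.assoc complex_norm_square del: of_real_power)
  finally have s: "s = z * of_real r" .
  have "cnj s = (\<Sum>i<n. \<Sum>j<n. of_real (A $$ (i, j)) * v $ i * cnj (v $ j))"
    unfolding s_def by (simp add: mult_ac)
  also have "\<dots> = (\<Sum>j<n. \<Sum>i<n. of_real (A $$ (i, j)) * v $ i * cnj (v $ j))"
    by (rule sum.swap)
  also have "\<dots> = s"
    unfolding s_def by (intro sum.cong refl) (simp add: symA)
  finally have "cnj s = s" .
  have "r \<noteq> 0"
  proof
    assume "r = 0"
    then have "\<forall>i<n. v $ i = 0"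
      unfolding r_def by (subst (asm) sum_nonneg_eq_0_iff) auto
    with v(1,2) show False by (auto simp: vec_eq_iff)
  qed
  with \<open>cnj s = s\<close> have "cnj z = z" unfolding s by simp
  then obtain y where y: "z = of_real y"
    by (metis Reals_cnj_iff Reals_cases)
  have "poly (char_poly ?C) z = 0"
    using ev eigenvalue_root_char_poly[OF C] by simp
  then have "poly (map_poly of_real (char_poly A)) (of_real y :: complex) = 0"
    by (simp add: y of_real_hom.char_poly_hom[OF A])
  then have "poly (char_poly A) y = 0"
    by simp
  then show ?thesis using y eigenvalue_root_char_poly[OF A] by blast
qed

text \<open>Over the complex numbers \<open>A - x I\<close> is similar to a strictly upper triangular matrix, so its square
  has trace 0; by symmetry this trace is the sum of the squared entries.\<close>

lemma symmetric_mat_single_eigenvalue: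
  fixes A :: "real mat"
  assumes A: "A \<in> carrier_mat n n" and sym: "transpose_mat A = A"
    and single: "\<And>y. eigenvalue A y \<Longrightarrow> y = x"
  shows "A = x \<cdot>\<^sub>m 1\<^sub>m n"
proof -
  let ?C = "map_mat of_real A :: complex mat"
  have C: "?C \<in> carrier_mat n n" using A by simp
  obtain es where es: "char_poly ?C = (\<Prod>e\<leftarrow>es. [:- e, 1:])"
    using char_poly_factorized[OF C] by blast
  have es_x: "e = of_real x" if "e \<in> set es" for e
  proof -
    have "poly (char_poly ?C) e = 0"
      using that unfolding es by (simp add: poly_prod_list prod_list_zero_iff image_iff)
    then show ?thesis
      using eigenvalue_of_real_symmetric_mat[OF A sym] single eigenvalue_root_char_poly[OF C] by blast
  qed
  obtain U P Q where U: "schur_decomposition ?C es = (U, P, Q)"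
    by (metis prod_cases3)
  from schur_decomposition[OF C es U]
  have wit: "similar_mat_wit ?C U P Q" and tri: "upper_triangular U" and diag: "diag_mat U = es"
    by auto
  have Uc: "U \<in> carrier_mat n n" using similar_mat_witD2[OF C wit] by simp
  have U_diag: "U $$ (i, i) = of_real x" if "i < n" for i
    using that Uc diag by (intro es_x) (auto simp: diag_mat_def)
  define N where "N = char_matrix U (of_real x)"
  define B where "B = char_matrix ?C (of_real x)"
  have wit': "similar_mat_wit B N P Q"
    unfolding B_def N_def by (rule similar_mat_wit_char_matrix[OF wit])
  have Bc: "B \<in> carrier_mat n n" unfolding B_def using C by (simp add: char_matrix_def)
  note w = similar_mat_witD2[OF Bc wit']
  have N_low: "N $$ (i, j) = 0" if "j \<le> i" "i < n" for i j
  proof (cases "j = i")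
    case True
    then show ?thesis using that Uc U_diag by (simp add: N_def char_matrix_def)
  next
    case False
    then show ?thesis
      using that Uc upper_triangularD[OF tri, of j i] by (simp add: N_def char_matrix_def)
  qed
  have "(\<Sum>i<n. (B * B) $$ (i, i)) = (\<Sum>i<n. (P * (N * N * Q)) $$ (i, i))"
  proof -
    have "B * B = P * N * (Q * P) * (N * Q)"
      using w(3-) by (simp add: assoc_mult_mat[of _ n n _ n _ n])
    also have "\<dots> = P * N * 1\<^sub>m n * (N * Q)"
      using w(2) by simp
    also have "\<dots> = P * (N * N * Q)"
      using w(4-) by (simp add: assoc_mult_mat[of _ n n _ n _ n])
    finally show ?thesis by simp
  qed
  \<comment> \<open>Cyclicity of the trace brings \<open>Q\<close> next to \<open>P\<close>, and
    \<open>Q * P\<close> is the identity.\<close>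
  also have "\<dots> = (\<Sum>i<n. (N * N) $$ (i, i))"
    using w by (subst trace_mult_commute[of _ n]) (simp_all add: assoc_mult_mat[of _ n n _ n _ n])
  also have "\<dots> = (\<Sum>i<n. \<Sum>j<n. N $$ (i, j) * N $$ (j, i))"
    using w by (intro sum.cong) (auto simp: scalar_prod_def atLeast0LessThan)
  \<comment> \<open>One of the positions (i, j) and (j, i) is on or below the diagonal, where
    \<open>N\<close> vanishes.\<close>
  also have "\<dots> = 0"
    by (intro sum.neutral ballI) (metis N_low lessThan_iff linorder_linear mult_zero_left mult_zero_right)
  finally have trace: "(\<Sum>i<n. (B * B) $$ (i, i)) = 0" .
  define M where "M = (\<lambda>i j. A $$ (i, j) - (if i = j then x else 0))"
  have B_entry: "B $$ (i, j) = of_real (M i j)" if "i < n" "j < n" for i j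
    using that A by (simp add: B_def char_matrix_def M_def)
  have M_sym: "M j i = M i j" if "i < n" "j < n" for i j
    using arg_cong[OF sym, of "\<lambda>M. M $$ (i, j)"] A that by (simp add: M_def)
  have "(\<Sum>i<n. (B * B) $$ (i, i)) = (\<Sum>i<n. \<Sum>j<n. of_real ((M i j)\<^sup>2))"
    using Bc by (intro sum.cong)
      (auto simp: scalar_prod_def atLeast0LessThan B_entry M_sym power2_eq_square intro!: sum.cong)
  then have "(\<Sum>i<n. \<Sum>j<n. (M i j)\<^sup>2) = 0"
    using trace by (simp flip: of_real_sum of_real_power)
  then have "\<forall>i<n. \<forall>j<n. M i j = 0"
    by (subst (asm) sum_nonneg_eq_0_iff) (auto simp: sum_nonneg sum_nonneg_eq_0_iff)
  then show ?thesis
    using A by (intro eq_matI) (auto simp: M_def)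
qed

text \<open>Finiteness matters because \<open>card\<close> of an infinite set is 0, so that a small
  \<open>card\<close> alone would not limit the eigenvalues.\<close>

lemma finite_eigenvalues:
  fixes A :: "'a::field mat"
  assumes "A \<in> carrier_mat n n"
  shows "finite {x. eigenvalue A x}"
proof -
  have "char_poly A \<noteq> 0"
    using degree_monic_char_poly[OF assms] by auto
  then show ?thesis
    using poly_roots_finite[of "char_poly A"] by (simp add: eigenvalue_root_char_poly[OF assms])
qed

lemma num_distinct_eigenvalues_ge_2:
  assumes A: "A \<in> carrier_mat n n" and sym: "transpose_mat A = A"
    and "i < n" "j < n" "i \<noteq> j" "A $$ (i, j) \<noteq> 0"
  shows "num_distinct_eigenvalues A \<ge> 2"
proof (rule ccontr)
  assume "\<not> num_distinct_eigenvalues A \<ge> 2"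
  then have "card {x. eigenvalue A x} \<le> Suc 0"
    by (simp add: num_distinct_eigenvalues_def)
  \<comment> \<open>This includes an empty set of eigenvalues, where any \<open>x\<close>
    works.\<close>
  then obtain x where "\<And>y. eigenvalue A y \<Longrightarrow> y = x"
    using card_le_Suc0_iff_eq[OF finite_eigenvalues[OF A]] by (metis mem_Collect_eq)
  from symmetric_mat_single_eigenvalue[OF A sym this] have "A = x \<cdot>\<^sub>m 1\<^sub>m n" .
  with assms show False by simp
qed

text \<open>Applying \<open>A\<close> twice to an eigenvector for x gives x^2 = x, so only 0 and 1
  can occur.\<close>

lemma num_distinct_eigenvalues_idempotent:
  assumes A: "A \<in> carrier_mat n n" and idem: "A * A = A"
  shows "num_distinct_eigenvalues A \<le> 2"
proof -
  have "{x. eigenvalue A x} \<subseteq> {0, 1}"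
  proof
    fix x assume "x \<in> {x. eigenvalue A x}"
    then obtain v where v: "v \<in> carrier_vec n" "v \<noteq> 0\<^sub>v n" "A *\<^sub>v v = x \<cdot>\<^sub>v v"
      using A by (auto simp: eigenvalue_def eigenvector_def)
    have "x \<cdot>\<^sub>v v = A *\<^sub>v (A *\<^sub>v v)"
      using A v by (metis idem assoc_mult_mat_vec)
    also have "\<dots> = x \<cdot>\<^sub>v (x \<cdot>\<^sub>v v)"
      using A v by (simp add: mult_mat_vec)
    finally have eq: "x \<cdot>\<^sub>v v = x \<cdot>\<^sub>v (x \<cdot>\<^sub>v v)" .
    obtain i where i: "i < n" "v $ i \<noteq> 0"
      using v(1,2) by (auto simp: vec_eq_iff)
    have "x * v $ i = x * (x * v $ i)"
      using arg_cong[OF eq, of "\<lambda>u. u $ i"] v(1) i(1) by simp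
    then show "x \<in> {0, 1}" using i(2) by simp
  qed
  then have "card {x. eigenvalue A x} \<le> card {0 :: real, 1}"
    by (intro card_mono) auto
  then show ?thesis by (simp add: num_distinct_eigenvalues_def)
qed

text \<open>Replaces numbered matrices by a kernel on the vertices. Under any numbering a symmetric
  idempotent kernel with the pattern of \<open>G\<close> becomes a matrix with at most two
  eigenvalues, while the arc from \<open>a\<close> to \<open>b\<close> gives every matrix of
  \<open>G\<close> a nonzero off-diagonal entry and hence at least two.\<close>

lemma q_graph_eq_2:
  fixes P :: "'a \<Rightarrow> 'a \<Rightarrow> real"
  assumes G: "pair_graph G"
    and P_sym: "\<And>x y. P x y = P y x"
    and P_idem: "\<And>x y. x \<in> pverts G \<Longrightarrow> y \<in> pverts G \<Longrightarrow> (\<Sum>z\<in>pverts G. P x z * P z y) = P x y"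
    and P_arc: "\<And>x y. x \<in> pverts G \<Longrightarrow> y \<in> pverts G \<Longrightarrow> x \<noteq> y \<Longrightarrow> P x y \<noteq> 0 \<longleftrightarrow> (x, y) \<in> parcs G"
    and arc: "(a, b) \<in> parcs G"
  shows "q_graph G = 2"
proof -
  define n where "n = card (pverts G)"
  have ge2: "num_distinct_eigenvalues A \<ge> 2" if "A \<in> graph_matrices G" for A
  proof -
    from that obtain lab where A: "A \<in> carrier_mat n n" "transpose_mat A = A"
      and lab: "bij_betw lab {..<n} (pverts G)"
      and pat: "\<And>i j. i < n \<Longrightarrow> j < n \<Longrightarrow> i \<noteq> j \<Longrightarrow> A $$ (i, j) \<noteq> 0 \<longleftrightarrow> (lab i, lab j) \<in> parcs G"
      unfolding graph_matrices_def n_def by blast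
    have "a \<in> lab ` {..<n}" "b \<in> lab ` {..<n}" "a \<noteq> b"
      using pair_graphD(2)[OF G arc] bij_betw_imp_surj_on[OF lab] by auto
    then obtain i j where "i < n" "j < n" "i \<noteq> j" "lab i = a" "lab j = b" by auto
    then show ?thesis
      using pat arc A by (intro num_distinct_eigenvalues_ge_2[of A n i j]) auto
  qed
  obtain lab where lab: "bij_betw lab {..<n} (pverts G)"
    using ex_bij_betw_nat_finite[OF pair_graphD(1)[OF G]]
    unfolding n_def atLeast0LessThan by blast
  have lab_in: "lab i \<in> pverts G" if "i < n" for i
    using that lab bij_betwE by fastforce
  define A where "A = mat n n (\<lambda>(i, j). P (lab i) (lab j))"
  have A: "A \<in> carrier_mat n n" by (simp add: A_def)
  have "transpose_mat A = A"
    by (rule eq_matI) (auto simp: A_def P_sym)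
  moreover have "A $$ (i, j) \<noteq> 0 \<longleftrightarrow> (lab i, lab j) \<in> parcs G" if "i < n" "j < n" "i \<noteq> j" for i j
    using that lab_in bij_betw_imp_inj_on[OF lab] by (auto simp: A_def P_arc inj_on_eq_iff)
  ultimately have "A \<in> graph_matrices G"
    using A lab unfolding graph_matrices_def n_def by blast
  moreover have "A * A = A"
  proof (rule eq_matI)
    fix i j assume "i < dim_row A" "j < dim_col A"
    then have ij: "i < n" "j < n" using A by auto
    have "(A * A) $$ (i, j) = (\<Sum>k<n. P (lab i) (lab k) * P (lab k) (lab j))"
      using ij by (simp add: A_def scalar_prod_def atLeast0LessThan)
    also have "\<dots> = (\<Sum>z\<in>pverts G. P (lab i) z * P z (lab j))"
      by (rule sum.reindex_bij_betw[OF lab])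
    also have "\<dots> = A $$ (i, j)"
      using ij lab_in P_idem by (simp add: A_def)
    finally show "(A * A) $$ (i, j) = A $$ (i, j)" .
  qed (simp_all add: A_def)
  ultimately have A2: "A \<in> graph_matrices G" "num_distinct_eigenvalues A = 2"
    using ge2 num_distinct_eigenvalues_idempotent[OF A] by (auto intro: le_antisym)
  then show ?thesis
    unfolding q_graph_def by (intro Least_equality) (use ge2 in auto)
qed

section \<open>Projections from disjoint blocks\<close>

text \<open>For disjoint finite nonempty blocks this is the orthogonal projection onto the span of
  their indicator vectors: it averages over each block.\<close>

definition block_proj :: "'v set set \<Rightarrow> 'v \<Rightarrow> 'v \<Rightarrow> real" where
  "block_proj F u v = (\<Sum>e\<in>F. of_bool (u \<in> e \<and> v \<in> e) / real (card e))"

lemma block_proj_commute: "block_proj F u v = block_proj F v u"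
  by (simp add: block_proj_def conj_commute)

text \<open>Products of different blocks vanish since no \<open>w\<close> lies in both, and in the
  square of one block the sum over \<open>w\<close> contributes a factor \<open>card e\<close>,
  which cancels one of the two denominators.\<close>

lemma block_proj_idem:
  assumes "finite V" "F \<subseteq> Pow V - {{}}" "disjoint F"
  shows "(\<Sum>w\<in>V. block_proj F u w * block_proj F w v) = block_proj F u v"
proof -
  have fin: "finite F" using assms(1,2) finite_subset[of F "Pow V"] by auto
  have fine: "finite e" "e \<noteq> {}" "e \<subseteq> V" if "e \<in> F" for e
    using that assms(1,2) by (auto intro: finite_subset)
  have "(\<Sum>w\<in>V. block_proj F u w * block_proj F w v) =
    (\<Sum>w\<in>V. \<Sum>e\<in>F. \<Sum>f\<in>F. of_bool (u \<in> e \<and> w \<in> e) / real (card e) * (of_bool (w \<in> f \<and> v \<in> f) / real (card f)))"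
    by (simp add: block_proj_def sum_product)
  also have "\<dots> = (\<Sum>w\<in>V. \<Sum>e\<in>F. of_bool (u \<in> e \<and> w \<in> e \<and> v \<in> e) / (real (card e))\<^sup>2)"
  proof (intro sum.cong refl)
    fix w e assume e: "e \<in> F"
    have "of_bool (u \<in> e \<and> w \<in> e) / real (card e) * (of_bool (w \<in> f \<and> v \<in> f) / real (card f)) =
      (if f = e then of_bool (u \<in> e \<and> w \<in> e \<and> v \<in> e) / (real (card e))\<^sup>2 else 0)" if "f \<in> F" for f
      using disjointD[OF assms(3) e that] by (auto simp: power2_eq_square)
    then show "(\<Sum>f\<in>F. of_bool (u \<in> e \<and> w \<in> e) / real (card e) * (of_bool (w \<in> f \<and> v \<in> f) / real (card f))) =
        of_bool (u \<in> e \<and> w \<in> e \<and> v \<in> e) / (real (card e))\<^sup>2"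
      using e fin by simp
  qed
  also have "\<dots> = (\<Sum>e\<in>F. \<Sum>w\<in>V. of_bool (u \<in> e \<and> w \<in> e \<and> v \<in> e) / (real (card e))\<^sup>2)"
    by (rule sum.swap)
  also have "\<dots> = block_proj F u v"
    unfolding block_proj_def
  proof (intro sum.cong refl)
    fix e assume e: "e \<in> F"
    have "(\<Sum>w\<in>V. of_bool (u \<in> e \<and> w \<in> e \<and> v \<in> e) / (real (card e))\<^sup>2) =
      (\<Sum>w\<in>e. of_bool (u \<in> e \<and> v \<in> e) / (real (card e))\<^sup>2)"
      using fine[OF e] assms(1) by (intro sum.mono_neutral_cong_right) auto
    also have "\<dots> = of_bool (u \<in> e \<and> v \<in> e) / real (card e)"
      using fine[OF e] by (simp add: power2_eq_square)
    finally show "(\<Sum>w\<in>V. of_bool (u \<in> e \<and> w \<in> e \<and> v \<in> e) / (real (card e))\<^sup>2) =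
      of_bool (u \<in> e \<and> v \<in> e) / real (card e)" .
  qed
  finally show ?thesis .
qed

lemma block_proj_block:
  assumes "finite F" "disjoint F" "e \<in> F" "u \<in> e" "v \<in> e"
  shows "block_proj F u v = 1 / real (card e)"
proof -
  have "block_proj F u v = (\<Sum>f\<in>F. if f = e then 1 / real (card e) else 0)"
    unfolding block_proj_def
    using disjointD[OF assms(2)] assms(3-5) by (intro sum.cong) auto
  then show ?thesis using assms(1,3) by simp
qed

lemma block_proj_eq_0:
  assumes "\<And>e. e \<in> F \<Longrightarrow> \<not> (u \<in> e \<and> v \<in> e)"
  shows "block_proj F u v = 0"
  unfolding block_proj_def using assms by (intro sum.neutral) auto

section \<open>An orthonormal basis from a reflection\<close>

text \<open>The squared weights sum to 1 and the first one exceeds 1/2, so no subset of them sums to 1/2.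
  The rows of the reflection \<open>I - 2 w w\<^sup>T\<close> are the basis \<open>x\<^sub>i\<close>.\<close>

definition hweight :: "nat \<Rightarrow> nat \<Rightarrow> real" where
  "hweight m i = sqrt (if i = 0 then (2 * real m + 1) / (3 * real m) else 1 / (3 * real m))"

definition hrefl :: "nat \<Rightarrow> nat \<Rightarrow> nat \<Rightarrow> real" where
  "hrefl m i a = of_bool (i = a) - 2 * hweight m i * hweight m a"

lemma hweight_pos: "m > 0 \<Longrightarrow> hweight m i > 0"
  by (simp add: hweight_def)

lemma hweight_square:
  "(hweight m i)\<^sup>2 = (if i = 0 then (2 * real m + 1) / (3 * real m) else 1 / (3 * real m))"
  by (simp add: hweight_def)

lemma sum_hweight_square:
  assumes "m > 0"
  shows "(\<Sum>i<m. (hweight m i)\<^sup>2) = 1"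
proof -
  obtain m' where m: "m = Suc m'" using assms by (cases m) auto
  have "(\<Sum>i<m. (hweight m i)\<^sup>2) = (2 * real m + 1) / (3 * real m) + (real m - 1) * (1 / (3 * real m))"
    unfolding m by (simp add: hweight_square sum.lessThan_Suc_shift del: sum.lessThan_Suc)
  also have "\<dots> = 1"
    using assms by (simp add: field_simps)
  finally show ?thesis .
qed

lemma hrefl_commute: "hrefl m i a = hrefl m a i"
  by (auto simp: hrefl_def)

text \<open>This is the entry (a, b) of X D X for the reflection X and the diagonal matrix D with
  entries \<open>t i\<close>. Constant \<open>t\<close> yields orthonormality, the indicator of a
  color set yields the diagonal blocks of the projection.\<close>

lemma hrefl_weighted_gram:
  assumes a: "a < m" and b: "b < m"
  shows "(\<Sum>i<m. t i * hrefl m i a * hrefl m i b) = of_bool (a = b) * t a +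
     2 * hweight m a * hweight m b * (2 * (\<Sum>i<m. t i * (hweight m i)\<^sup>2) - t a - t b)"
proof -
  \<comment> \<open>Expanding the product leaves a term at i = a, one at i = b and one for all i;
    the contribution of the case a = b is placed at i = a.\<close>
  have "(\<Sum>i<m. t i * hrefl m i a * hrefl m i b) =
    (\<Sum>i<m. (if i = a then of_bool (a = b) * t a - 2 * t a * hweight m a * hweight m b else 0)
        + (if i = b then - (2 * t b * hweight m a * hweight m b) else 0)
        + 4 * hweight m a * hweight m b * (t i * (hweight m i)\<^sup>2))"
    by (intro sum.cong refl) (auto simp: hrefl_def algebra_simps power2_eq_square)
  also have "\<dots> = of_bool (a = b) * t a - 2 * t a * hweight m a * hweight m b
        - 2 * t b * hweight m a * hweight m b
        + 4 * hweight m a * hweight m b * (\<Sum>i<m. t i * (hweight m i)\<^sup>2)"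
    using a b by (simp add: sum.distrib flip: sum_distrib_left)
  finally show ?thesis by (simp add: algebra_simps)
qed

text \<open>With all \<open>t i\<close> equal to 1 the bracket in \<open>hrefl_weighted_gram\<close>
  is 2 - 1 - 1 = 0, as the weight vector is a unit vector.\<close>

lemma hrefl_orthogonal:
  assumes "a < m" "b < m"
  shows "(\<Sum>i<m. hrefl m a i * hrefl m b i) = of_bool (a = b)"
  using hrefl_weighted_gram[OF assms, of "\<lambda>_. 1"] sum_hweight_square[of m] assms
  by (simp add: hrefl_commute[of m a] hrefl_commute[of m b])

lemma hrefl_nonzero:
  assumes "m > 0"
  shows "hrefl m i a \<noteq> 0"
proof (cases "i = a")
  case True
  have "(hweight m a)\<^sup>2 \<noteq> 1 / 2"
  proof
    assume "(hweight m a)\<^sup>2 = 1 / 2"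
    \<comment> \<open>Clearing denominators gives 4m + 2 = 3m or 2 = 3m, both impossible for a
      positive integer m.\<close>
    then have "real (2 * (2 * m + 1)) = real (3 * m) \<or> real 2 = real (3 * m)"
      using assms by (auto simp: hweight_square field_simps split: if_splits)
    then show False unfolding of_nat_eq_iff using assms by presburger
  qed
  then show ?thesis using True by (simp add: hrefl_def power2_eq_square)
next
  case False
  then show ?thesis
    using hweight_pos[OF assms, of i] hweight_pos[OF assms, of a] by (simp add: hrefl_def)
qed

text \<open>For a \<noteq> b the sum is a nonzero multiple of 2 p(S) minus the number of elements of
  {a, b} in S, where p(S) is the total squared weight of S. It could vanish only for p(S) equal to
  0, 1/2 or 1, and the weights exclude all three.\<close>

lemma hrefl_restricted_gram_nonzero:
  assumes ab: "a < m" "b < m" "a \<noteq> b" and S: "S \<subseteq> {..<m}" "S \<noteq> {}" "S \<noteq> {..<m}" and "s \<noteq> 0"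
  shows "(\<Sum>i<m. s * of_bool (i \<in> S) * hrefl m i a * hrefl m i b) \<noteq> 0"
proof -
  have m: "m > 0" using ab by simp
  define p where "p T = (\<Sum>i\<in>T. (hweight m i)\<^sup>2)" for T
  have p_pos: "p T > 0" if "T \<subseteq> {..<m}" "T \<noteq> {}" for T
    unfolding p_def using that m finite_subset[of T "{..<m}"] hweight_pos[OF m]
    by (intro sum_pos) (auto simp: less_imp_neq[symmetric])
  have total: "p S + p ({..<m} - S) = 1"
    using sum.subset_diff[OF S(1), of "\<lambda>i. (hweight m i)\<^sup>2"] sum_hweight_square[OF m]
    by (simp add: p_def)
  have big: "p T > 1 / 2" if "0 \<in> T" "T \<subseteq> {..<m}" for T
  proof -
    have "1 / 2 < (hweight m 0)\<^sup>2" using m by (simp add: hweight_square field_simps)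
    also have "\<dots> = p {0}" by (simp add: p_def)
    also have "\<dots> \<le> p T"
      unfolding p_def using that finite_subset[of T "{..<m}"] by (intro sum_mono2) auto
    finally show ?thesis .
  qed
  have "p S > 0" "p S < 1"
    using p_pos[of S] p_pos[of "{..<m} - S"] S total by auto
  \<comment> \<open>Either \<open>S\<close> or its complement contains 0 and so has more than half
    of the total.\<close>
  moreover have "p S \<noteq> 1 / 2"
    using big[of S] big[of "{..<m} - S"] S m total by (cases "0 \<in> S") auto
  ultimately have "2 * p S - of_bool (a \<in> S) - of_bool (b \<in> S) \<noteq> 0"
    by auto
  moreover have "(\<Sum>i<m. of_bool (i \<in> S) * (hweight m i)\<^sup>2) = p S"
    unfolding p_def using S(1) by (intro sum.mono_neutral_cong_right) auto
  ultimately have "(\<Sum>i<m. of_bool (i \<in> S) * hrefl m i a * hrefl m i b) \<noteq> 0"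
    using hweight_pos[OF m, of a] hweight_pos[OF m, of b] ab
    by (simp add: hrefl_weighted_gram[of a m b "\<lambda>i. of_bool (i \<in> S)"])
  then show ?thesis
    using \<open>s \<noteq> 0\<close> by (simp add: mult.assoc flip: sum_distrib_left)
qed

text \<open>The matrix of \<open>\<Sum>\<^sub>i Q\<^sub>i \<otimes> x\<^sub>i x\<^sub>i\<^sup>T\<close>.\<close>

definition tensor_proj :: "nat \<Rightarrow> (nat \<Rightarrow> 'v \<Rightarrow> 'v \<Rightarrow> real) \<Rightarrow> 'v \<times> nat \<Rightarrow> 'v \<times> nat \<Rightarrow> real" where
  "tensor_proj m Q x y = (\<Sum>i<m. Q i (fst x) (fst y) * hrefl m i (snd x) * hrefl m i (snd y))"

text \<open>The product of the summands for colors i and j carries the inner product of x_i and x_j,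
  so orthonormality leaves only the squares, and these reduce to the idempotency of each
  \<open>Q i\<close>.\<close>

lemma tensor_proj_idem:
  assumes Q: "\<And>i. i < m \<Longrightarrow> (\<Sum>w\<in>V. Q i u w * Q i w v) = Q i u v"
  shows "(\<Sum>z\<in>V \<times> {..<m}. tensor_proj m Q (u, a) z * tensor_proj m Q z (v, b)) =
    tensor_proj m Q (u, a) (v, b)"
proof -
  let ?X = "hrefl m"
  have "(\<Sum>z\<in>V \<times> {..<m}. tensor_proj m Q (u, a) z * tensor_proj m Q z (v, b)) =
    (\<Sum>w\<in>V. \<Sum>d<m. \<Sum>i<m. \<Sum>j<m. Q i u w * ?X i a * ?X i d * (Q j w v * ?X j d * ?X j b))"
    by (simp add: sum.cartesian_product' tensor_proj_def sum_product)
  \<comment> \<open>The sum over \<open>d\<close> is moved innermost, where it becomes the inner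
    product of two basis vectors.\<close>
  also have "\<dots> = (\<Sum>w\<in>V. \<Sum>i<m. \<Sum>j<m. \<Sum>d<m. Q i u w * ?X i a * ?X i d * (Q j w v * ?X j d * ?X j b))"
    by (rule sum.cong[OF refl], subst sum.swap, rule sum.cong[OF refl], rule sum.swap)
  also have "\<dots> = (\<Sum>w\<in>V. \<Sum>i<m. \<Sum>j<m. if j = i then Q i u w * Q i w v * ?X i a * ?X i b else 0)"
  proof (intro sum.cong refl)
    fix w i j assume "i \<in> {..<m}" "j \<in> {..<m}"
    have "(\<Sum>d<m. Q i u w * ?X i a * ?X i d * (Q j w v * ?X j d * ?X j b)) =
      (Q i u w * Q j w v * ?X i a * ?X j b) * (\<Sum>d<m. ?X i d * ?X j d)"
      by (simp add: sum_distrib_left mult_ac)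
    then show "(\<Sum>d<m. Q i u w * ?X i a * ?X i d * (Q j w v * ?X j d * ?X j b)) =
      (if j = i then Q i u w * Q i w v * ?X i a * ?X i b else 0)"
      using \<open>i \<in> {..<m}\<close> \<open>j \<in> {..<m}\<close> by (simp add: hrefl_orthogonal)
  qed
  also have "\<dots> = (\<Sum>w\<in>V. \<Sum>i<m. Q i u w * Q i w v * ?X i a * ?X i b)"
    by simp
  also have "\<dots> = (\<Sum>i<m. (\<Sum>w\<in>V. Q i u w * Q i w v) * ?X i a * ?X i b)"
    by (subst sum.swap) (simp add: sum_distrib_right)
  also have "\<dots> = tensor_proj m Q (u, a) (v, b)"
    by (simp add: tensor_proj_def Q)
  finally show ?thesis .
qed

section \<open>Vertices and arcs of the two products with a complete graph\<close>

lemma pverts_strong_product_complete: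
  "pverts (G \<boxtimes> complete_graph m) = pverts G \<times> {..<m}"
  "pverts (G \<boxtimes>\<^sub>~ complete_graph m) = pverts G \<times> {..<m}"
  by (simp_all add: strong_product_def modified_strong_product_def complete_graph_def)

lemma parcs_strong_product_complete:
  "((u, a), (v, b)) \<in> parcs (G \<boxtimes> complete_graph m) \<longleftrightarrow>
     a < m \<and> b < m \<and> ((u, v) \<in> parcs G \<or> u = v \<and> u \<in> pverts G \<and> a \<noteq> b)"
  "((u, a), (v, b)) \<in> parcs (G \<boxtimes>\<^sub>~ complete_graph m) \<longleftrightarrow>
     a < m \<and> b < m \<and> (u, v) \<in> parcs G"
  by (auto simp: strong_product_def modified_strong_product_def complete_graph_def)

section \<open>Edge-colored linear hypergraphs\<close>

text \<open>An isolated vertex is a block of color 0 of its own; otherwise its diagonal block in \<open>P\<close> would vanish.\<close>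

definition color_blocks :: "'v hypergraph \<Rightarrow> ('v set \<Rightarrow> nat) \<Rightarrow> nat \<Rightarrow> 'v set set" where
  "color_blocks H \<phi> i = {e \<in> hedges H. \<phi> e = i} \<union>
     (if i = 0 then {{u} | u. u \<in> hverts H \<and> hdegree H u = 0} else {})"

text \<open>The number \<open>m\<close> of available colors is a free parameter, so that it can be
  the chromatic index or exceed it by one.\<close>

locale colored_linear_hypergraph = fin_hypergraph H for H :: "'v hypergraph" +
  fixes l m :: nat and \<phi> :: "'v set \<Rightarrow> nat"
  assumes l: "l \<ge> 2"
    and unif: "uniform_hypergraph l H"
    and lin: "linear_hypergraph H"
    and col: "proper_edge_coloring H m \<phi>"
    and m_pos: "m > 0"
begin

lemma card_hedge: "e \<in> hedges H \<Longrightarrow> card e = l"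
  using unif by (simp add: uniform_hypergraph_def)

lemma hdegree_eq_0_iff: "hdegree H u = 0 \<longleftrightarrow> (\<forall>e\<in>hedges H. u \<notin> e)"
  using finite_hedges by (auto simp: hdegree_def)

lemma hedge_unique:
  assumes "e \<in> hedges H" "e' \<in> hedges H" "u \<in> e \<inter> e'" "v \<in> e \<inter> e'" "u \<noteq> v"
  shows "e = e'"
proof (rule ccontr)
  assume "e \<noteq> e'"
  then have "card (e \<inter> e') \<le> 1" using lin assms(1,2) by (simp add: linear_hypergraph_def)
  moreover have "finite (e \<inter> e')"
    using assms(1) finite_hverts hedges_subset by (auto intro: finite_subset)
  ultimately show False
    using assms(3-5) card_le_Suc0_iff_eq[of "e \<inter> e'"] by auto
qed

lemma color_blocks_subset: "color_blocks H \<phi> i \<subseteq> Pow (hverts H) - {{}}"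
  using hedges_subset card_hedge[of "{}"] l by (auto simp: color_blocks_def split: if_splits)

lemma finite_color_blocks: "finite (color_blocks H \<phi> i)"
  using color_blocks_subset finite_hverts by (meson Diff_subset finite_Pow_iff finite_subset)

text \<open>Hyperedges of one color are disjoint because the coloring is proper, and an added
  singleton consists of a vertex outside all hyperedges.\<close>

lemma disjoint_color_blocks: "disjoint (color_blocks H \<phi> i)"
proof (rule disjointI)
  fix e f assume ef: "e \<in> color_blocks H \<phi> i" "f \<in> color_blocks H \<phi> i" "e \<noteq> f"
  have block: "g \<in> hedges H \<and> \<phi> g = i \<or> g = {x} \<and> (\<forall>e\<in>hedges H. x \<notin> e)"
    if "g \<in> color_blocks H \<phi> i" "x \<in> g" for g x
    using that by (auto simp: color_blocks_def hdegree_eq_0_iff split: if_splits)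
  show "e \<inter> f = {}"
  proof (rule ccontr)
    assume "e \<inter> f \<noteq> {}"
    then obtain x where "x \<in> e" "x \<in> f" by blast
    \<comment> \<open>If one block were the singleton of an isolated \<open>x\<close>, the other
      would be the same singleton, against e \<noteq> f.\<close>
    then have "e \<in> hedges H" "f \<in> hedges H" "\<phi> e = \<phi> f"
      using block ef by metis+
    then show False
      using col ef(3) \<open>e \<inter> f \<noteq> {}\<close> by (auto simp: proper_edge_coloring_def)
  qed
qed

section \<open>The projection \<open>P\<close> and its blocks at two distinct vertices\<close>

abbreviation Q :: "nat \<Rightarrow> 'v \<Rightarrow> 'v \<Rightarrow> real" where
  "Q i \<equiv> block_proj (color_blocks H \<phi> i)"

abbreviation P :: "'v \<times> nat \<Rightarrow> 'v \<times> nat \<Rightarrow> real" where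
  "P \<equiv> tensor_proj m Q"

lemma P_commute: "P x y = P y x"
  by (simp add: tensor_proj_def block_proj_commute mult_ac)

lemma P_idem: "(\<Sum>z\<in>hverts H \<times> {..<m}. P x z * P z y) = P x y"
  using tensor_proj_idem[where V = "hverts H" and Q = Q and u = "fst x" and v = "fst y"
      and a = "snd x" and b = "snd y"]
    block_proj_idem[OF finite_hverts color_blocks_subset disjoint_color_blocks]
  by simp

text \<open>By linearity adjacent vertices share exactly one hyperedge, so only its color
  contributes and the block is the rank one matrix of a nowhere zero basis vector, divided by
  \<open>l\<close>. For nonadjacent vertices every \<open>Q i u v\<close> is 0.\<close>

lemma P_offdiag:
  assumes "u \<noteq> v"
  shows "P (u, a) (v, b) \<noteq> 0 \<longleftrightarrow> (u, v) \<in> parcs (representing_graph H)"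
proof (cases "(u, v) \<in> parcs (representing_graph H)")
  case True
  then obtain e where e: "e \<in> hedges H" "u \<in> e" "v \<in> e"
    by (auto simp: representing_graph_def)
  have "\<phi> e < m" using col e(1) by (simp add: proper_edge_coloring_def)
  have "Q i u v = (if i = \<phi> e then 1 / real l else 0)" for i
  proof (cases "i = \<phi> e")
    case True
    have "e \<in> color_blocks H \<phi> i" using e(1) True by (simp add: color_blocks_def)
    then show ?thesis
      using block_proj_block[OF finite_color_blocks disjoint_color_blocks _ e(2,3)] True
        card_hedge[OF e(1)] by simp
  next
    case False
    have "\<not> (u \<in> f \<and> v \<in> f)" if "f \<in> color_blocks H \<phi> i" for f
    proof
      assume f: "u \<in> f \<and> v \<in> f"
      then have "f \<in> hedges H" "\<phi> f = i"
        using that assms by (auto simp: color_blocks_def split: if_splits)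
      then show False
        using hedge_unique[of f e u v] e f assms False by simp
    qed
    then show ?thesis using False by (simp add: block_proj_eq_0)
  qed
  then have "P (u, a) (v, b) = (\<Sum>i<m. if i = \<phi> e then 1 / real l * hrefl m i a * hrefl m i b else 0)"
    unfolding tensor_proj_def by (intro sum.cong) auto
  then show ?thesis
    using True \<open>\<phi> e < m\<close> hrefl_nonzero[OF m_pos] l by simp
next
  case False
  have "Q i u v = 0" for i
    using False assms
    by (auto simp: color_blocks_def representing_graph_def split: if_splits intro!: block_proj_eq_0)
  then show ?thesis using False by (simp add: tensor_proj_def)
qed

section \<open>Colors at a vertex and the diagonal blocks of \<open>P\<close>\<close>

definition vertex_colors :: "'v \<Rightarrow> nat set" where
  "vertex_colors u = \<phi> ` {e \<in> hedges H. u \<in> e}"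

text \<open>A proper coloring is injective on the hyperedges through \<open>u\<close>. Thus degree
  \<open>m\<close> means that all colors occur at \<open>u\<close>, and a smaller degree that some
  color is missing.\<close>

lemma card_vertex_colors: "card (vertex_colors u) = hdegree H u"
  unfolding vertex_colors_def hdegree_def
  using col by (intro card_image inj_onI) (auto simp: proper_edge_coloring_def)

lemma vertex_colors_subset: "vertex_colors u \<subseteq> {..<m}"
  using col by (auto simp: vertex_colors_def proper_edge_coloring_def)

lemma Q_diag:
  assumes "hdegree H u > 0"
  shows "Q i u u = 1 / real l * of_bool (i \<in> vertex_colors u)"
proof (cases "i \<in> vertex_colors u")
  case True
  then obtain e where e: "e \<in> hedges H" "u \<in> e" "\<phi> e = i" by (auto simp: vertex_colors_def)
  then have "e \<in> color_blocks H \<phi> i" by (simp add: color_blocks_def)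
  then show ?thesis
    using block_proj_block[OF finite_color_blocks disjoint_color_blocks _ e(2,2)] True
      card_hedge[OF e(1)] by simp
next
  case False
  then show ?thesis
    using assms
    by (auto simp: color_blocks_def vertex_colors_def split: if_splits intro!: block_proj_eq_0)
qed

text \<open>The singleton block lets an isolated vertex act as if its color set were {0}; the
  right-hand side is written to match \<open>hrefl_restricted_gram_nonzero\<close>.\<close>

lemma Q_diag_isolated:
  assumes "u \<in> hverts H" "hdegree H u = 0"
  shows "Q i u u = of_bool (i \<in> {0})"
proof (cases "i = 0")
  case True
  then have "{u} \<in> color_blocks H \<phi> i" using assms by (auto simp: color_blocks_def)
  then show ?thesis
    using block_proj_block[OF finite_color_blocks disjoint_color_blocks, of "{u}" i u u] True by simp
next
  case False
  then show ?thesis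
    using assms(2) hdegree_eq_0_iff by (auto simp: color_blocks_def intro!: block_proj_eq_0)
qed

text \<open>The colors at \<open>u\<close>, or {0} if \<open>u\<close> is isolated, form a nonempty
  proper subset of the \<open>m\<close> colors, as \<open>hrefl_restricted_gram_nonzero\<close>
  requires.\<close>

lemma P_diag_nonzero:
  assumes "u \<in> hverts H" "hdegree H u < m" "a < m" "b < m" "a \<noteq> b"
  shows "P (u, a) (u, b) \<noteq> 0"
proof (cases "hdegree H u = 0")
  case True
  \<comment> \<open>Two distinct indices below \<open>m\<close> exist, which makes {0} a proper
    subset.\<close>
  have "m \<ge> 2" using assms by linarith
  then have "1 \<in> {..<m}" by simp
  then have "{0} \<noteq> {..<m}" by auto
  then have "(\<Sum>i<m. 1 * of_bool (i \<in> {0}) * hrefl m i a * hrefl m i b) \<noteq> 0"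
    using m_pos assms by (intro hrefl_restricted_gram_nonzero) auto
  then show ?thesis by (simp add: tensor_proj_def Q_diag_isolated[OF assms(1) True])
next
  case False
  have "vertex_colors u \<noteq> {}" "vertex_colors u \<noteq> {..<m}"
    using card_vertex_colors[of u] False assms(2) by (metis card.empty, metis card_lessThan less_irrefl)
  then have "(\<Sum>i<m. 1 / real l * of_bool (i \<in> vertex_colors u) * hrefl m i a * hrefl m i b) \<noteq> 0"
    using assms vertex_colors_subset l by (intro hrefl_restricted_gram_nonzero) auto
  then show ?thesis using False by (simp add: tensor_proj_def Q_diag)
qed

text \<open>All colors occur at \<open>u\<close>, so the full orthonormal basis is summed and the
  diagonal block is the identity divided by \<open>l\<close>.\<close>

lemma P_diag_eq_0:
  assumes "hdegree H u = m" "a < m" "b < m" "a \<noteq> b"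
  shows "P (u, a) (u, b) = 0"
proof -
  have "vertex_colors u = {..<m}"
    using card_vertex_colors[of u] assms(1) vertex_colors_subset by (simp add: card_subset_eq)
  then have "P (u, a) (u, b) = 1 / real l * (\<Sum>i<m. hrefl m a i * hrefl m b i)"
    using assms(1) m_pos
    by (simp add: tensor_proj_def Q_diag sum_distrib_left hrefl_commute[of m a] hrefl_commute[of m b])
  then show ?thesis using assms by (simp add: hrefl_orthogonal)
qed

section \<open>The value of q for the two products\<close>

lemma ex_arc:
  assumes "hedges H \<noteq> {}"
  shows "\<exists>u v. (u, v) \<in> parcs (representing_graph H)"
proof -
  obtain e where e: "e \<in> hedges H" using assms by blast
  then have "\<not> card e \<le> Suc 0" using card_hedge l by simp
  then obtain u v where "u \<in> e" "v \<in> e" "u \<noteq> v"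
    using e card_le_Suc0_iff_eq[of e] finite_hverts hedges_subset
    by (metis card.infinite le0)
  then show ?thesis using e by (auto simp: representing_graph_def)
qed

text \<open>The degree bound makes the diagonal blocks of \<open>P\<close> nonzero off their
  diagonal, matching the copy of the complete graph over each vertex.\<close>

lemma q_graph_strong_product:
  assumes "hedges H \<noteq> {}" and deg: "\<And>u. u \<in> hverts H \<Longrightarrow> hdegree H u < m"
  shows "q_graph (representing_graph H \<boxtimes> complete_graph m) = 2"
proof -
  obtain u v where uv: "(u, v) \<in> parcs (representing_graph H)"
    using ex_arc[OF assms(1)] by blast
  show ?thesis
  proof (rule q_graph_eq_2)
    show "pair_graph (representing_graph H \<boxtimes> complete_graph m)"
      by (intro pair_graph_strong_product pair_graph_representing_graph pair_graph_complete_graph)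
    show "((u, 0), (v, 0)) \<in> parcs (representing_graph H \<boxtimes> complete_graph m)"
      using uv m_pos by (simp add: parcs_strong_product_complete)
    have verts: "pverts (representing_graph H \<boxtimes> complete_graph m) = hverts H \<times> {..<m}"
      by (simp add: pverts_strong_product_complete representing_graph_def)
    show "(\<Sum>z\<in>pverts (representing_graph H \<boxtimes> complete_graph m). P x z * P z y) = P x y" for x y
      unfolding verts by (rule P_idem)
    fix x y
    assume "x \<in> pverts (representing_graph H \<boxtimes> complete_graph m)"
      "y \<in> pverts (representing_graph H \<boxtimes> complete_graph m)" "x \<noteq> y"
    then show "P x y \<noteq> 0 \<longleftrightarrow> (x, y) \<in> parcs (representing_graph H \<boxtimes> complete_graph m)"
      unfolding verts
      by (cases x; cases y; cases "fst x = fst y")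
        (auto simp: parcs_strong_product_complete P_offdiag P_diag_nonzero deg representing_graph_def)
  qed (rule P_commute)
qed

text \<open>Full degree at every vertex makes the diagonal blocks of \<open>P\<close> diagonal,
  matching the absence of arcs over a single vertex.\<close>

lemma q_graph_modified_strong_product:
  assumes "hedges H \<noteq> {}" and deg: "\<And>u. u \<in> hverts H \<Longrightarrow> hdegree H u = m"
  shows "q_graph (representing_graph H \<boxtimes>\<^sub>~ complete_graph m) = 2"
proof -
  obtain u v where uv: "(u, v) \<in> parcs (representing_graph H)"
    using ex_arc[OF assms(1)] by blast
  show ?thesis
  proof (rule q_graph_eq_2)
    show "pair_graph (representing_graph H \<boxtimes>\<^sub>~ complete_graph m)"
      by (intro pair_graph_modified_strong_product pair_graph_representing_graph pair_graph_complete_graph)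
    show "((u, 0), (v, 0)) \<in> parcs (representing_graph H \<boxtimes>\<^sub>~ complete_graph m)"
      using uv m_pos by (simp add: parcs_strong_product_complete)
    have verts: "pverts (representing_graph H \<boxtimes>\<^sub>~ complete_graph m) = hverts H \<times> {..<m}"
      by (simp add: pverts_strong_product_complete representing_graph_def)
    show "(\<Sum>z\<in>pverts (representing_graph H \<boxtimes>\<^sub>~ complete_graph m). P x z * P z y) = P x y" for x y
      unfolding verts by (rule P_idem)
    fix x y
    assume "x \<in> pverts (representing_graph H \<boxtimes>\<^sub>~ complete_graph m)"
      "y \<in> pverts (representing_graph H \<boxtimes>\<^sub>~ complete_graph m)" "x \<noteq> y"
    then show "P x y \<noteq> 0 \<longleftrightarrow> (x, y) \<in> parcs (representing_graph H \<boxtimes>\<^sub>~ complete_graph m)"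
      unfolding verts
      by (cases x; cases y; cases "fst x = fst y")
        (auto simp: parcs_strong_product_complete P_offdiag P_diag_eq_0 deg representing_graph_def)
  qed (rule P_commute)
qed

end

lemma proper_edge_coloring_mono:
  "proper_edge_coloring H m \<phi> \<Longrightarrow> m \<le> m' \<Longrightarrow> proper_edge_coloring H m' \<phi>"
  unfolding proper_edge_coloring_def by (meson order_less_le_trans)

theorem theorem3p5:
  fixes H :: "'v hypergraph" and G :: "'v pair_pre_digraph" and l k c :: nat
  assumes "l \<ge> 2"
    and "fin_hypergraph H"
    and "uniform_hypergraph l H"
    and "linear_hypergraph H"
    and "hedges H \<noteq> {}"
    and "max_hdegree H = k"
    and "chromatic_index H = c"
    and "G = representing_graph H"
  shows "(c > k \<longrightarrow> q_graph (G \<boxtimes> complete_graph c) = 2) \<and>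
         (c = k \<longrightarrow> q_graph (G \<boxtimes> complete_graph (c + 1)) = 2) \<and>
         (regular_hypergraph k H \<and> c = k \<longrightarrow> q_graph (G \<boxtimes>\<^sub>~ complete_graph c) = 2)"
proof -
  interpret fin_hypergraph H by fact
  obtain \<phi> where \<phi>: "proper_edge_coloring H c \<phi>"
    using chromatic_index_attained assms(7) by blast
  have "c > 0"
    using \<phi> assms(5) by (auto simp: proper_edge_coloring_def)
  have colored: "colored_linear_hypergraph H l m \<phi>" if "c \<le> m" for m
    using that assms(1,3,4) \<open>c > 0\<close> proper_edge_coloring_mono[OF \<phi> that] by unfold_locales auto
  have deg: "hdegree H u \<le> k" if "u \<in> hverts H" for u
    using that finite_hverts unfolding assms(6)[symmetric] max_hdegree_def by simp
  show ?thesis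
  \<comment> \<open>In the first case all degrees are at most k < c; in the second the extra color
    gives k < c + 1; in the third regularity makes every degree equal to \<open>c\<close>.\<close>
  proof (intro conjI impI)
    assume "c > k"
    then show "q_graph (G \<boxtimes> complete_graph c) = 2"
      unfolding assms(8)
      by (intro colored_linear_hypergraph.q_graph_strong_product[OF colored assms(5)])
        (auto dest: deg)
  next
    assume "c = k"
    then show "q_graph (G \<boxtimes> complete_graph (c + 1)) = 2"
      unfolding assms(8)
      by (intro colored_linear_hypergraph.q_graph_strong_product[OF colored assms(5)])
        (auto dest: deg)
  next
    assume "regular_hypergraph k H \<and> c = k"
    then show "q_graph (G \<boxtimes>\<^sub>~ complete_graph c) = 2"
      unfolding assms(8)
      by (intro colored_linear_hypergraph.q_graph_modified_strong_product[OF colored assms(5)])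
        (auto simp: regular_hypergraph_def)
  qed
qed

end
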